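(* Let $\mathcal G$ be the bow graph, with directed edge $X\to Y$ and bidirected edge $X\leftrightarrow Y$. Suppose the observational distribution $P(X,Y)$, the interventional distributions $P(Y_x)$ for all $x$, and the counterfactual distributions $P(Y_x\mid X)$ for all $x$ are given. Then for all values $x\neq x'$ of $X$ and all values $y,y'$ of $Y$, the query $P(Y_x=y\mid X=x',Y=y')$ (written $P(y_x\mid x',y')$) is tightly bounded in the range $[l',r']$, where $$l'=\max\Big\{0,\frac{P(y_x\mid x')-(1-P(y'\mid x'))}{P(y'\mid x')}\Big\},\qquad r'=\min\Big\{1,\frac{P(y_x\mid x')}{P(y'\mid x')}\Big\}.$$ Further, $[l',r']\subseteq[l,r]$, where $$l=\max\Big\{0,\frac{\alpha_{\min}-(1-P(y'\mid x'))}{P(y'\mid x')}\Big\},\qquad r=\min\Big\{1,\frac{\alpha_{\max}}{P(y'\mid x')}\Big\},$$ $$\alpha_{\min}=\max\Big\{0,\frac{P(y_x)-(1-P(x'))}{P(x')}\Big\},\qquad \alpha_{\max}=\min\Big\{1,\frac{P(y_x)}{P(x')}\Big\}.$$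
   Context: $X,Y$ have finite domains. An SCM compatible with the bow graph consists of exogenous $\mathbf U\sim P(\mathbf u)$ and functions $X=f_X(\mathbf U)$, $Y=f_Y(X,\mathbf U)$ (arbitrary shared exogenous variables allowed). $Y_x(\mathbf u)=f_Y(x,\mathbf u)$ is the potential response; $P(y_x)=P(Y_x=y)$, $P(y_x\mid x')=P(Y_x=y\mid X=x')$, $P(y'\mid x')=P(Y=y'\mid X=x')$. The given data are the distributions induced by some such SCM, and $P(X,Y)$ is strictly positive. A range $[l',r']$ tightly bounds a query if, over all SCMs compatible with the graph that induce the given data, the query always lies in $[l',r']$, and there exist such SCMs in which the query takes each boundary value, i.e. it is the smallest such interval. (Tightness is with respect to SCMs not otherwise required to have all counterfactual probabilities positive.) *)

theory Defs
  imports "HOL-Probability.Probability"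
begin

text \<open>
  Structural causal models compatible with the bow graph (a directed edge from X to Y and a
  bidirected edge between them).  The exogenous space is an arbitrary probability space whose
  outcomes may be shared by both mechanisms.  The finite domains of X and Y are the types
  \<open>'x\<close> and \<open>'y\<close>.
\<close>

record ('u, 'x, 'y) bow_scm =
  exo :: "'u measure"
  f\<^sub>X :: "'u \<Rightarrow> 'x"
  f\<^sub>Y :: "'x \<Rightarrow> 'u \<Rightarrow> 'y"

definition is_bow_scm :: "('u, 'x::finite, 'y::finite) bow_scm \<Rightarrow> bool" where
  "is_bow_scm M \<longleftrightarrow>
     prob_space (exo M) \<and>
     f\<^sub>X M \<in> measurable (exo M) (count_space UNIV) \<and>
     (\<forall>x. f\<^sub>Y M x \<in> measurable (exo M) (count_space UNIV))"

definition X_of :: "('u, 'x, 'y) bow_scm \<Rightarrow> 'u \<Rightarrow> 'x" where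
  "X_of M u = f\<^sub>X M u"

definition Y_of :: "('u, 'x, 'y) bow_scm \<Rightarrow> 'u \<Rightarrow> 'y" where
  "Y_of M u = f\<^sub>Y M (X_of M u) u"

text \<open>The potential response \<open>Y\<^sub>x(u)\<close>: the mechanism of X is replaced by the constant x.\<close>

definition Y_do :: "('u, 'x, 'y) bow_scm \<Rightarrow> 'x \<Rightarrow> 'u \<Rightarrow> 'y" where
  "Y_do M x u = f\<^sub>Y M x u"

text \<open>
  In order: \<open>P(x, y)\<close>, \<open>P(x)\<close>, \<open>P(y | x)\<close>, \<open>P(y\<^sub>x)\<close>, \<open>P(y\<^sub>x | x')\<close> and \<open>P(y\<^sub>x | x', y')\<close>.
\<close>

definition p_xy :: "('u, 'x, 'y) bow_scm \<Rightarrow> 'x \<Rightarrow> 'y \<Rightarrow> real" where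
  "p_xy M x y = \<P>(u in exo M. X_of M u = x \<and> Y_of M u = y)"

definition p_x :: "('u, 'x, 'y) bow_scm \<Rightarrow> 'x \<Rightarrow> real" where
  "p_x M x = \<P>(u in exo M. X_of M u = x)"

definition p_y_given_x :: "('u, 'x, 'y) bow_scm \<Rightarrow> 'y \<Rightarrow> 'x \<Rightarrow> real" where
  "p_y_given_x M y x = \<P>(u in exo M. Y_of M u = y \<bar> X_of M u = x)"

definition p_do :: "('u, 'x, 'y) bow_scm \<Rightarrow> 'x \<Rightarrow> 'y \<Rightarrow> real" where
  "p_do M x y = \<P>(u in exo M. Y_do M x u = y)"

definition p_do_given_x :: "('u, 'x, 'y) bow_scm \<Rightarrow> 'x \<Rightarrow> 'y \<Rightarrow> 'x \<Rightarrow> real" where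
  "p_do_given_x M x y x' = \<P>(u in exo M. Y_do M x u = y \<bar> X_of M u = x')"

definition p_do_given_xy :: "('u, 'x, 'y) bow_scm \<Rightarrow> 'x \<Rightarrow> 'y \<Rightarrow> 'x \<Rightarrow> 'y \<Rightarrow> real" where
  "p_do_given_xy M x y x' y' =
     \<P>(u in exo M. Y_do M x u = y \<bar> X_of M u = x' \<and> Y_of M u = y')"

text \<open>
  \<open>M\<close> and \<open>N\<close> induce the same \<open>P(X, Y)\<close>, the same \<open>P(Y\<^sub>x)\<close> for all x, and the same
  \<open>P(Y\<^sub>x | X)\<close> for all x.  Their exogenous spaces may have different types.
\<close>

definition same_data :: "('u, 'x, 'y) bow_scm \<Rightarrow> ('v, 'x, 'y) bow_scm \<Rightarrow> bool" where
  "same_data M N \<longleftrightarrow>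
     (\<forall>x y. p_xy M x y = p_xy N x y) \<and>
     (\<forall>x y. p_do M x y = p_do N x y) \<and>
     (\<forall>x y x'. p_do_given_x M x y x' = p_do_given_x N x y x')"

end

theory Submission
  imports Defs
begin

text \<open>
  Conditioning on \<open>X = x'\<close> reduces the bounds to the Frechet inequalities for the events
  \<open>Y\<^sub>x = y\<close> and \<open>Y\<^sub>x\<^sub>' = y'\<close>, because consistency gives \<open>Y = Y\<^sub>x\<^sub>'\<close> there.  For tightness, the law of
  \<open>(X, (Y\<^sub>z)\<^sub>z)\<close> in the given model is itself a model; on the event \<open>X = x'\<close> one resamples the
  coordinate \<open>Y\<^sub>x\<close> from one law \<open>\<mu>\<close> if \<open>Y\<^sub>x\<^sub>' = y'\<close> and from another law \<open>\<nu>\<close> otherwise.  The data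
  only depend on the laws of the pairs \<open>(X, Y\<^sub>w)\<close>, so they are unchanged as soon as the mixture of
  \<open>\<mu>\<close> and \<open>\<nu>\<close> is the law of \<open>Y\<^sub>x\<close> given \<open>x'\<close>, whereas the query becomes \<open>\<mu>(y)\<close>.
\<close>

section \<open>The data as functions of the laws of the pairs \<open>(X, Y_w)\<close>\<close>

definition p_x_do :: "('u, 'x, 'y) bow_scm \<Rightarrow> 'x \<Rightarrow> 'x \<Rightarrow> 'y \<Rightarrow> real" where
  "p_x_do M z w a = \<P>(u in exo M. X_of M u = z \<and> Y_do M w u = a)"

lemma p_xy_eq: "p_xy M z a = p_x_do M z z a"
  unfolding p_xy_def p_x_do_def Y_of_def Y_do_def
  by (rule arg_cong[where f = "measure (exo M)"]) auto

lemma p_do_given_x_eq: "p_do_given_x M w a z = p_x_do M z w a / p_x M z"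
  by (simp add: p_do_given_x_def cond_prob_def p_x_do_def p_x_def conj_commute)

lemma p_y_given_x_eq: "p_y_given_x M a z = p_x_do M z z a / p_x M z"
  by (simp add: p_y_given_x_def cond_prob_def p_xy_eq[symmetric] p_xy_def p_x_def conj_commute)

text \<open>Consistency, \<open>Y = Y_z\<close> on \<open>X = z\<close>, turns the numerator into
  the probability of two potential-response events intersected inside \<open>X = z\<close>.\<close>

lemma p_do_given_xy_eq:
  "p_do_given_xy M w a z b =
     \<P>(u in exo M. X_of M u = z \<and> Y_do M w u = a \<and> Y_do M z u = b) / p_xy M z b"
proof -
  have "{u \<in> space (exo M). Y_do M w u = a \<and> X_of M u = z \<and> Y_of M u = b} =
        {u \<in> space (exo M). X_of M u = z \<and> Y_do M w u = a \<and> Y_do M z u = b}"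
    by (auto simp: Y_of_def Y_do_def)
  then show ?thesis
    by (simp add: p_do_given_xy_def cond_prob_def p_xy_def)
qed

lemma
  assumes "is_bow_scm M"
  shows prob_space_exo: "prob_space (exo M)"
    and measurable_X_of: "X_of M \<in> exo M \<rightarrow>\<^sub>M count_space UNIV"
    and measurable_Y_do: "Y_do M w \<in> exo M \<rightarrow>\<^sub>M count_space UNIV"
  using assms by (simp_all add: is_bow_scm_def X_of_def[abs_def] Y_do_def[abs_def])

text \<open>The free choice of \<open>w\<close> matters: \<open>w = z\<close> sums the observational
  probabilities, while another \<open>w\<close> normalises the law of \<open>Y_w\<close> given
  \<open>X = z\<close>.\<close>

lemma p_x_eq_sum:
  assumes "is_bow_scm M"
  shows "p_x M z = (\<Sum>a\<in>UNIV. p_x_do M z w a)"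
proof -
  interpret prob_space "exo M" using assms by (rule prob_space_exo)
  note [measurable] = measurable_X_of[OF assms] measurable_Y_do[OF assms]
  have "p_x M z = prob (\<Union>a\<in>UNIV. {u \<in> space (exo M). X_of M u = z \<and> Y_do M w u = a})"
    unfolding p_x_def by (rule arg_cong[where f = prob]) auto
  also have "\<dots> = (\<Sum>a\<in>UNIV. p_x_do M z w a)"
    unfolding p_x_do_def
    by (subst finite_measure_finite_Union) (auto simp: disjoint_family_on_def)
  finally show ?thesis .
qed

lemma p_do_eq_sum:
  assumes "is_bow_scm M"
  shows "p_do M w a = (\<Sum>z\<in>UNIV. p_x_do M z w a)"
proof -
  interpret prob_space "exo M" using assms by (rule prob_space_exo)
  note [measurable] = measurable_X_of[OF assms] measurable_Y_do[OF assms]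
  have "p_do M w a = prob (\<Union>z\<in>UNIV. {u \<in> space (exo M). X_of M u = z \<and> Y_do M w u = a})"
    unfolding p_do_def by (rule arg_cong[where f = prob]) auto
  also have "\<dots> = (\<Sum>z\<in>UNIV. p_x_do M z w a)"
    unfolding p_x_do_def
    by (subst finite_measure_finite_Union) (auto simp: disjoint_family_on_def)
  finally show ?thesis .
qed

text \<open>The table \<open>p_x_do\<close> determines all the data: its diagonal is
  \<open>P(x, y)\<close>, its marginals are \<open>P(x)\<close> and \<open>P(y_x)\<close>, and its
  quotients by \<open>P(x')\<close> are \<open>P(y_x | x')\<close>.\<close>

lemma same_dataI:
  assumes "is_bow_scm M" "is_bow_scm N"
    and "\<And>z w a. p_x_do M z w a = p_x_do N z w a"
  shows "same_data M N"
proof -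
  have "p_x M z = p_x N z" for z
    using assms by (simp add: p_x_eq_sum[where w = z])
  then show ?thesis
    using assms by (simp add: same_data_def p_do_given_x_eq p_xy_eq p_do_eq_sum)
qed

lemma same_dataD:
  assumes "is_bow_scm M" "is_bow_scm N" "same_data M N"
  shows "p_xy M z a = p_xy N z a" "p_do M w a = p_do N w a"
    "p_do_given_x M w a z = p_do_given_x N w a z"
    "p_x M z = p_x N z" "p_y_given_x M a z = p_y_given_x N a z"
  using assms by (simp_all add: same_data_def p_y_given_x_eq p_x_eq_sum[where w = z] flip: p_xy_eq)

section \<open>Frechet bounds\<close>

lemma p_do_given_xy_bounds:
  assumes "is_bow_scm M" and pos: "p_xy M x' y' > 0"
  shows "p_do_given_xy M x y x' y' \<in>
    {max 0 ((p_do_given_x M x y x' - (1 - p_y_given_x M y' x')) / p_y_given_x M y' x') ..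
     min 1 (p_do_given_x M x y x' / p_y_given_x M y' x')}"
proof -
  interpret prob_space "exo M" using assms(1) by (rule prob_space_exo)
  note [measurable] = measurable_X_of[OF assms(1)] measurable_Y_do[OF assms(1)]
  define A where "A = {u \<in> space (exo M). X_of M u = x' \<and> Y_do M x u = y}"
  define B where "B = {u \<in> space (exo M). X_of M u = x' \<and> Y_do M x' u = y'}"
  define C where "C = {u \<in> space (exo M). X_of M u = x'}"
  have ms[measurable]: "A \<in> events" "B \<in> events" "C \<in> events"
    unfolding A_def B_def C_def by measurable
  have pB: "prob B = p_xy M x' y'" by (simp add: B_def p_xy_eq p_x_do_def)
  have q: "p_do_given_xy M x y x' y' = prob (A \<inter> B) / prob B"
    unfolding p_do_given_xy_eq pB
    by (rule arg_cong[where f = "\<lambda>S. prob S / _"]) (auto simp: A_def B_def)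
  have g: "p_do_given_x M x y x' = prob A / prob C" "p_y_given_x M y' x' = prob B / prob C"
    by (simp_all add: p_do_given_x_eq p_y_given_x_eq p_x_do_def p_x_def A_def B_def C_def)
  have "prob B \<le> prob C" by (rule finite_measure_mono) (auto simp: B_def C_def)
  with pos pB have pos': "prob B > 0" "prob C > 0" by auto
  have le: "prob (A \<inter> B) \<le> prob A" "prob (A \<inter> B) \<le> prob B"
    by (auto intro: finite_measure_mono)
  \<comment> \<open>Inclusion-exclusion with \<open>C\<close> in place of the whole space yields the
    lower bound.\<close>
  have "prob (A \<union> B) \<le> prob C" by (rule finite_measure_mono) (auto simp: A_def B_def C_def)
  moreover have "prob (A \<union> B) = prob A + prob B - prob (A \<inter> B)"
    using ms by (simp add: measure_Un3 fmeasurable_eq_sets)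
  ultimately have "prob A + prob B - prob C \<le> prob (A \<inter> B)" by linarith
  then have "(prob A + prob B - prob C) / prob B \<le> prob (A \<inter> B) / prob B"
    using pos' by (intro divide_right_mono) auto
  \<comment> \<open>The factor \<open>1 / prob C\<close> cancels, which matches the conditional form
    of the bound with its joint form.\<close>
  moreover have "(prob A / prob C - (1 - prob B / prob C)) / (prob B / prob C) =
      (prob A + prob B - prob C) / prob B"
    using pos' by (simp add: field_simps)
  moreover have "prob (A \<inter> B) / prob B \<le> prob A / prob B" "prob (A \<inter> B) / prob B \<le> 1"
    using le pos' by (auto intro: divide_right_mono)
  ultimately show ?thesis unfolding q g using pos' by simp
qed

text \<open>Both endpoints increase with the probability in the numerator. Replacing
  \<open>P(y_x | x')\<close> by a lower estimate on the left and an upper one on the right therefore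
  widens the interval, which gives \<open>[l', r'] \<subseteq> [l, r]\<close>.\<close>

lemma mono_frechet_bounds:
  fixes c a b d :: real
  assumes "c > 0" "a \<le> b" "b \<le> d"
  shows "{max 0 ((b - (1 - c)) / c) .. min 1 (b / c)} \<subseteq> {max 0 ((a - (1 - c)) / c) .. min 1 (d / c)}"
proof -
  have "(a - (1 - c)) / c \<le> (b - (1 - c)) / c" "b / c \<le> d / c"
    using assms by (auto intro!: divide_right_mono)
  then show ?thesis by auto
qed

text \<open>The Frechet argument again, now in the whole space for the events \<open>Y_x = y\<close>
  and \<open>X = x'\<close>. The endpoints are \<alpha>_min and \<alpha>_max.\<close>

lemma p_do_given_x_bounds:
  assumes "is_bow_scm M" and pos: "p_x M x' > 0"
  shows "p_do_given_x M x y x' \<in>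
    {max 0 ((p_do M x y - (1 - p_x M x')) / p_x M x') .. min 1 (p_do M x y / p_x M x')}"
proof -
  interpret prob_space "exo M" using assms(1) by (rule prob_space_exo)
  note [measurable] = measurable_X_of[OF assms(1)] measurable_Y_do[OF assms(1)]
  define A where "A = {u \<in> space (exo M). Y_do M x u = y}"
  define C where "C = {u \<in> space (exo M). X_of M u = x'}"
  have ms[measurable]: "A \<in> events" "C \<in> events"
    unfolding A_def C_def by measurable
  have p: "p_do M x y = prob A" "p_x M x' = prob C"
    by (simp_all add: p_do_def p_x_def A_def C_def)
  have q: "p_do_given_x M x y x' = prob (A \<inter> C) / prob C"
    unfolding p_do_given_x_eq p p_x_do_def
    by (rule arg_cong[where f = "\<lambda>S. prob S / _"]) (auto simp: A_def C_def)
  have le: "prob (A \<inter> C) \<le> prob A" "prob (A \<inter> C) \<le> prob C"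
    by (auto intro: finite_measure_mono)
  have "prob (A \<union> C) = prob A + prob C - prob (A \<inter> C)"
    using ms by (simp add: measure_Un3 fmeasurable_eq_sets)
  then have "prob A + prob C - 1 \<le> prob (A \<inter> C)"
    using prob_le_1[of "A \<union> C"] by linarith
  then have "(prob A - (1 - prob C)) / prob C \<le> prob (A \<inter> C) / prob C"
    using pos p by (intro divide_right_mono) auto
  moreover have "prob (A \<inter> C) / prob C \<le> prob A / prob C" "prob (A \<inter> C) / prob C \<le> 1"
    using le pos p by (auto intro: divide_right_mono)
  ultimately show ?thesis unfolding q p by simp
qed

section \<open>Laws on finite types and their splitting into mixtures\<close>

lemma ex_pmf_of_sum_1:
  fixes f :: "'a::finite \<Rightarrow> real"
  assumes "\<And>a. f a \<ge> 0" "(\<Sum>a\<in>UNIV. f a) = 1"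
  shows "\<exists>p. \<forall>a. pmf p a = f a"
proof -
  have "(\<integral>\<^sup>+ a. ennreal (f a) \<partial>count_space UNIV) = 1"
    using assms by (simp add: nn_integral_count_space_finite sum_ennreal)
  then show ?thesis
    using pmf_embed_pmf[of f] assms by auto
qed

text \<open>For \<open>c < 1\<close>, a law \<mu> is a component of weight \<open>c\<close> once
  \<open>c * pmf \<mu> a \<le> pmf q a\<close> everywhere, with \<nu> the normalised remainder. At
  \<open>y\<close> this is the upper bound on \<open>t\<close>; away from \<open>y\<close> the mass
  \<open>c * (1 - t)\<close> must fit into \<open>1 - pmf q y\<close>, which is the lower
  bound.\<close>

lemma ex_pmf_decomposition:
  fixes q :: "'a::finite pmf"
  assumes "0 < c" "c \<le> 1" "max 0 ((pmf q y - (1 - c)) / c) \<le> t" "t \<le> min 1 (pmf q y / c)"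
  shows "\<exists>\<mu> \<nu>. (\<forall>a. c * pmf \<mu> a + (1 - c) * pmf \<nu> a = pmf q a) \<and> pmf \<mu> y = t"
proof (cases "c = 1")
  case True
  \<comment> \<open>The two bounds force \<open>t = pmf q y\<close>; \<open>q\<close> itself serves
    as \<mu>, and \<nu> has weight 0.\<close>
  then show ?thesis using assms by auto
next
  case False
  \<comment> \<open>\<open>\<mu>\<close> is proportional to \<open>q\<close> away from \<open>y\<close>.  If \<open>q\<close> is concentrated at \<open>y\<close>, then \<open>\<beta> = 0 / 0 = 0\<close>
    and \<open>t = 1\<close>, so the construction still works.\<close>
  define \<beta> where "\<beta> = (1 - t) / (1 - pmf q y)"
  define m where "m a = (if a = y then t else pmf q a * \<beta>)" for a
  have t: "0 \<le> t" "t \<le> 1" "c * t \<le> pmf q y" "pmf q y - (1 - c) \<le> c * t"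
    using assms by (auto simp: field_simps)
  have qsum: "(\<Sum>a\<in>UNIV - {y}. pmf q a) = 1 - pmf q y"
    using sum_pmf_eq_1[of UNIV q] by (simp add: sum.remove[of UNIV y])
  have tq: "t = 1" if "pmf q y = 1"
  proof -
    from that t(4) have "c * 1 \<le> c * t" by simp
    with assms(1) t(2) show ?thesis by (simp only: mult_le_cancel_left_pos)
  qed
  \<comment> \<open>When \<open>pmf q y < 1\<close>, the second claim rearranges
    \<open>pmf q y - (1 - c) \<le> c * t\<close>.\<close>
  have \<beta>: "\<beta> \<ge> 0" "c * \<beta> \<le> 1"
    using t pmf_le_1[of q y] by (auto simp: \<beta>_def divide_simps algebra_simps)
  have "(1 - pmf q y) * \<beta> = 1 - t"
    using tq by (auto simp: \<beta>_def)
  then have msum: "(\<Sum>a\<in>UNIV. m a) = 1"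
    by (simp add: sum.remove[of UNIV y] m_def qsum flip: sum_distrib_right)
  have m: "m a \<ge> 0" "c * m a \<le> pmf q a" for a
    using t \<beta> mult_left_mono[of "c * \<beta>" 1 "pmf q a"] by (auto simp: m_def algebra_simps)
  obtain \<mu> where \<mu>: "pmf \<mu> a = m a" for a
    using ex_pmf_of_sum_1[of m] m msum by blast
  have "(\<Sum>a\<in>UNIV. (pmf q a - c * m a) / (1 - c)) = 1"
    using False
    by (simp add: sum_pmf_eq_1 sum_subtractf msum flip: sum_divide_distrib sum_distrib_left)
  moreover have "(pmf q a - c * m a) / (1 - c) \<ge> 0" for a
    using m assms by simp
  ultimately obtain \<nu> where "pmf \<nu> a = (pmf q a - c * m a) / (1 - c)" for a
    using ex_pmf_of_sum_1[of "\<lambda>a. (pmf q a - c * m a) / (1 - c)"] by blast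
  then have "c * pmf \<mu> a + (1 - c) * pmf \<nu> a = pmf q a" for a
    using False by (simp add: \<mu>)
  moreover have "pmf \<mu> y = t" by (simp add: \<mu> m_def)
  ultimately show ?thesis by blast
qed

section \<open>Canonical models: the exogenous state is a value of X together with a response
  function\<close>

definition canonical_scm :: "('x \<times> ('x \<Rightarrow> 'y)) pmf \<Rightarrow> ('x \<times> ('x \<Rightarrow> 'y), 'x, 'y) bow_scm" where
  "canonical_scm p = \<lparr>exo = measure_pmf p, f\<^sub>X = fst, f\<^sub>Y = (\<lambda>x u. snd u x)\<rparr>"

lemma is_bow_scm_canonical: "is_bow_scm (canonical_scm p)"
  by (simp add: is_bow_scm_def canonical_scm_def measure_pmf.prob_space_axioms)

lemma p_x_do_canonical:
  "p_x_do (canonical_scm p) z w a = measure_pmf.prob p {u. fst u = z \<and> snd u w = a}"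
  by (simp add: p_x_do_def canonical_scm_def X_of_def Y_do_def)

lemma ex_pmf_law:
  fixes f :: "'u \<Rightarrow> 'a::finite"
  assumes "prob_space M" "f \<in> M \<rightarrow>\<^sub>M count_space UNIV"
  shows "\<exists>p. \<forall>A. measure_pmf.prob p A = measure M (f -` A \<inter> space M)"
proof -
  interpret prob_space M by fact
  have vs: "f -` A \<inter> space M \<in> sets M" for A
    using assms(2) by (rule measurable_sets) simp
  have *: "prob (f -` A \<inter> space M) = (\<Sum>a\<in>A. prob (f -` {a} \<inter> space M))" for A
  proof -
    have "f -` A \<inter> space M = (\<Union>a\<in>A. f -` {a} \<inter> space M)" by auto
    also have "prob \<dots> = (\<Sum>a\<in>A. prob (f -` {a} \<inter> space M))"
      by (rule finite_measure_finite_Union) (auto simp: disjoint_family_on_def vs)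
    finally show ?thesis .
  qed
  have "(\<Sum>a\<in>UNIV. prob (f -` {a} \<inter> space M)) = 1"
    using *[of UNIV] prob_space by simp
  then obtain p where "pmf p a = prob (f -` {a} \<inter> space M)" for a
    using ex_pmf_of_sum_1[of "\<lambda>a. prob (f -` {a} \<inter> space M)"] by auto
  then have "measure_pmf.prob p A = prob (f -` A \<inter> space M)" for A
    by (simp add: measure_measure_pmf_finite *[of A])
  then show ?thesis by blast
qed

text \<open>The law of \<open>(X, (Y_z)_z)\<close> under \<open>M\<close> replaces an arbitrary
  exogenous space by a finite one, where resampling reduces to finite sums.\<close>

lemma ex_canonical_scm:
  fixes M :: "('u, 'x::finite, 'y::finite) bow_scm"
  assumes "is_bow_scm M"
  shows "\<exists>p. \<forall>z w a. p_x_do (canonical_scm p) z w a = p_x_do M z w a"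
proof -
  define f where "f u = (X_of M u, \<lambda>z. Y_do M z u)" for u
  note [measurable] = measurable_X_of[OF assms] measurable_Y_do[OF assms]
  have "f -` {(z, g)} \<inter> space (exo M) \<in> sets (exo M)" for z g
  proof -
    have "f -` {(z, g)} \<inter> space (exo M) =
      {u \<in> space (exo M). X_of M u = z \<and> (\<forall>w. Y_do M w u = g w)}"
      by (auto simp: f_def)
    also have "\<dots> \<in> sets (exo M)" by measurable
    finally show ?thesis .
  qed
  then have "f \<in> exo M \<rightarrow>\<^sub>M count_space UNIV"
    by (subst measurable_count_space_eq2) auto
  then obtain p where p: "measure_pmf.prob p A = measure (exo M) (f -` A \<inter> space (exo M))" for A
    using ex_pmf_law[OF prob_space_exo[OF assms]] by blast
  have "p_x_do (canonical_scm p) z w a = p_x_do M z w a" for z w a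
    unfolding p_x_do_canonical p unfolding p_x_do_def
    by (rule arg_cong[where f = "measure (exo M)"]) (auto simp: f_def)
  then show ?thesis by blast
qed

section \<open>Resampling one potential response by a Markov kernel\<close>

definition resample :: "'x \<Rightarrow> 'x \<Rightarrow> 'y \<Rightarrow> 'y pmf \<Rightarrow> 'y pmf \<Rightarrow> 'x \<times> ('x \<Rightarrow> 'y) \<Rightarrow>
    ('x \<times> ('x \<Rightarrow> 'y)) pmf" where
  "resample x x' y' \<mu> \<nu> u =
     (if fst u = x'
      then map_pmf (\<lambda>a. (x', (snd u)(x := a))) (if snd u x' = y' then \<mu> else \<nu>)
      else return_pmf u)"

lemma prob_bind_pmf_finite:
  fixes p :: "'a::finite pmf"
  shows "measure_pmf.prob (bind_pmf p k) A = (\<Sum>u\<in>UNIV. pmf p u * measure_pmf.prob (k u) A)"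
proof -
  have "measure_pmf.prob (bind_pmf p k) A = measure_pmf.expectation p (\<lambda>u. measure_pmf.prob (k u) A)"
    unfolding measure_pmf_bind
    by (rule measure_pmf.measure_bind[where N = "count_space UNIV"])
      (auto simp: space_subprob_algebra measure_pmf.subprob_space_axioms)
  also have "\<dots> = (\<Sum>u\<in>UNIV. measure_pmf.prob (k u) A * pmf p u)"
    by (rule integral_measure_pmf_real) auto
  finally show ?thesis by (simp add: mult.commute)
qed

lemma prob_eq_sum_indicator:
  fixes p :: "'a::finite pmf"
  shows "measure_pmf.prob p A = (\<Sum>u\<in>UNIV. pmf p u * indicator A u)"
  by (simp add: measure_measure_pmf_finite indicator_def if_distrib cong: if_cong)

text \<open>Applied with \<open>h\<close> the masses of the canonical law, \<open>f\<close> the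
  indicator of \<open>X = x', Y_x' = y'\<close> and \<open>g\<close> that of \<open>X = x'\<close>,
  so that only the probabilities of these two events remain.\<close>

lemma sum_mixture:
  fixes f g h :: "'a \<Rightarrow> real"
  shows "(\<Sum>u\<in>A. h u * (m * f u + n * (g u - f u))) =
    m * (\<Sum>u\<in>A. h u * f u) + n * ((\<Sum>u\<in>A. h u * g u) - (\<Sum>u\<in>A. h u * f u))"
  by (simp add: algebra_simps sum.distrib sum_subtractf sum_distrib_left)

text \<open>The kernel keeps X and every response except \<open>Y_x\<close> on
  \<open>X = x'\<close>, so membership in these events is preserved with certainty.\<close>

lemma prob_resample_other:
  assumes "z \<noteq> x' \<or> w \<noteq> x"
  shows "measure_pmf.prob (resample x x' y' \<mu> \<nu> u) {u. fst u = z \<and> snd u w = a} =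
    indicator {u. fst u = z \<and> snd u w = a} u"
  using assms by (auto simp: resample_def indicator_def measure_return_pmf)

text \<open>Since \<open>x \<noteq> x'\<close>, the fresh value of \<open>Y_x\<close> leaves intact
  the response \<open>Y_x'\<close> that selected \<mu> or \<nu>. The difference of indicators is
  that of \<open>X = x', Y_x' \<noteq> y'\<close>.\<close>

lemma prob_resample_at:
  assumes "x \<noteq> x'"
  shows "measure_pmf.prob (resample x x' y' \<mu> \<nu> u) {u. fst u = x' \<and> snd u x = a} =
      pmf \<mu> a * indicator {u. fst u = x' \<and> snd u x' = y'} u +
      pmf \<nu> a * (indicator {u. fst u = x'} u - indicator {u. fst u = x' \<and> snd u x' = y'} u)"
    "measure_pmf.prob (resample x x' y' \<mu> \<nu> u) {u. fst u = x' \<and> snd u x = a \<and> snd u x' = y'} =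
      pmf \<mu> a * indicator {u. fst u = x' \<and> snd u x' = y'} u"
  using assms
  by (auto simp: resample_def indicator_def measure_return_pmf vimage_def measure_pmf_single)

text \<open>Both endpoints come from one construction with arbitrary \<open>t\<close>: split the law
  of \<open>Y_x\<close> given \<open>x'\<close> with weight \<open>P(y' | x')\<close> and resample
  from the two parts.\<close>

lemma ex_scm_attaining:
  fixes M :: "('u, 'x::finite, 'y::finite) bow_scm"
  assumes scm: "is_bow_scm M" and pos: "p_xy M x' y' > 0" and neq: "x \<noteq> x'"
    and t: "max 0 ((p_do_given_x M x y x' - (1 - p_y_given_x M y' x')) / p_y_given_x M y' x') \<le> t"
      "t \<le> min 1 (p_do_given_x M x y x' / p_y_given_x M y' x')"
  shows "\<exists>N :: ('x \<times> ('x \<Rightarrow> 'y), 'x, 'y) bow_scm.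
    is_bow_scm N \<and> same_data M N \<and> p_do_given_xy N x y x' y' = t"
proof -
  obtain p where p: "p_x_do (canonical_scm p) z w a = p_x_do M z w a" for z w a
    using ex_canonical_scm[OF scm] by blast
  define D where "D = p_x M x'"
  define c where "c = p_y_given_x M y' x'"
  have nonneg: "p_x_do M z w a \<ge> 0" for z w a by (simp add: p_x_do_def)
  \<comment> \<open>Expanding \<open>P(x')\<close> over the values of \<open>Y_x'\<close> makes
    \<open>P(x', y')\<close> one of the summands.\<close>
  have "p_xy M x' y' \<le> D"
    unfolding D_def p_xy_eq p_x_eq_sum[OF scm, where w = x']
    by (rule member_le_sum) (auto simp: nonneg)
  then have D: "D > 0" and c: "c > 0" "c \<le> 1" and Dc: "p_xy M x' y' = D * c"
    using pos by (auto simp: c_def D_def p_y_given_x_eq p_xy_eq)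
  have "(\<Sum>a\<in>UNIV. p_do_given_x M x a x') = 1"
    using D by (simp add: p_do_given_x_eq D_def p_x_eq_sum[OF scm, where w = x]
        flip: sum_divide_distrib)
  then obtain q where q: "pmf q a = p_do_given_x M x a x'" for a
    using ex_pmf_of_sum_1[of "\<lambda>a. p_do_given_x M x a x'"] D nonneg
    by (auto simp: p_do_given_x_eq D_def)
  obtain \<mu> \<nu> where mix: "c * pmf \<mu> a + (1 - c) * pmf \<nu> a = pmf q a" and \<mu>: "pmf \<mu> y = t" for a
    using ex_pmf_decomposition[of c q y t] c t unfolding q c_def by blast
  let ?B = "{u. fst u = x' \<and> snd u x' = y'}"
  have prob_B: "(\<Sum>u\<in>UNIV. pmf p u * indicator ?B u) = D * c"
    using p[of x' x' y'] Dc by (simp add: p_x_do_canonical p_xy_eq flip: prob_eq_sum_indicator)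
  have prob_C: "(\<Sum>u\<in>UNIV. pmf p u * indicator {u. fst u = x'} u) = D"
  proof -
    have "p_x (canonical_scm p) x' = D"
      by (simp add: D_def p p_x_eq_sum[OF is_bow_scm_canonical, where w = x]
          p_x_eq_sum[OF scm, where w = x])
    then show ?thesis
      by (simp add: p_x_def canonical_scm_def X_of_def flip: prob_eq_sum_indicator)
  qed
  define r where "r = bind_pmf p (resample x x' y' \<mu> \<nu>)"
  have same: "p_x_do M z w a = p_x_do (canonical_scm r) z w a" for z w a
  proof (cases "z \<noteq> x' \<or> w \<noteq> x")
    case True
    show ?thesis
      unfolding p[symmetric] p_x_do_canonical r_def prob_bind_pmf_finite
        prob_resample_other[OF True]
      by (rule prob_eq_sum_indicator)
  next
    case False
    \<comment> \<open>This is the only pair law that resampling touches: mass \<open>D * c\<close>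
      draws from \<mu> and the rest of \<open>D\<close> from \<nu>, so \<open>mix\<close> restores
      the old law.\<close>
    have "p_x_do (canonical_scm r) x' x a =
        pmf \<mu> a * (D * c) + pmf \<nu> a * (D - D * c)"
      unfolding p_x_do_canonical r_def prob_bind_pmf_finite prob_resample_at(1)[OF neq]
        sum_mixture prob_B prob_C ..
    also have "\<dots> = D * pmf q a"
      by (simp add: algebra_simps flip: mix)
    also have "\<dots> = p_x_do M x' x a"
      using D by (simp add: q p_do_given_x_eq D_def)
    finally show ?thesis using False by simp
  qed
  \<comment> \<open>On this event only draws from \<mu> occur; dividing by
    \<open>P(x', y') = D * c\<close> leaves \<open>t\<close>.\<close>
  have "measure_pmf.prob r {u. fst u = x' \<and> snd u x = y \<and> snd u x' = y'} = t * (D * c)"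
    unfolding r_def prob_bind_pmf_finite prob_resample_at(2)[OF neq] \<mu> prob_B[symmetric]
      sum_distrib_left
    by (rule sum.cong) (simp_all only: mult.left_commute)
  moreover have "p_xy (canonical_scm r) x' y' = D * c"
    using same Dc by (simp add: p_xy_eq)
  ultimately have "p_do_given_xy (canonical_scm r) x y x' y' = t"
    using D c by (simp add: p_do_given_xy_eq) (simp add: canonical_scm_def X_of_def Y_do_def)
  then show ?thesis
    using same_dataI[OF scm is_bow_scm_canonical same] is_bow_scm_canonical by blast
qed

theorem proposition5p4:
  fixes M :: "('u, 'x::finite, 'y::finite) bow_scm"
    and x x' :: 'x and y y' :: 'y
    and l' r' l r \<alpha>_min \<alpha>_max :: real
  assumes scm: "is_bow_scm M"
    and positive: "\<forall>a b. p_xy M a b > 0"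
    and neq: "x \<noteq> x'"
    and l': "l' = max 0 ((p_do_given_x M x y x' - (1 - p_y_given_x M y' x')) / p_y_given_x M y' x')"
    and r': "r' = min 1 (p_do_given_x M x y x' / p_y_given_x M y' x')"
    and \<alpha>_min: "\<alpha>_min = max 0 ((p_do M x y - (1 - p_x M x')) / p_x M x')"
    and \<alpha>_max: "\<alpha>_max = min 1 (p_do M x y / p_x M x')"
    and l: "l = max 0 ((\<alpha>_min - (1 - p_y_given_x M y' x')) / p_y_given_x M y' x')"
    and r: "r = min 1 (\<alpha>_max / p_y_given_x M y' x')"
  shows "(\<forall>N :: ('v, 'x, 'y) bow_scm.
            is_bow_scm N \<and> same_data M N \<longrightarrow> p_do_given_xy N x y x' y' \<in> {l'..r'}) \<and>
         (\<exists>N :: ('x \<times> ('x \<Rightarrow> 'y), 'x, 'y) bow_scm.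
            is_bow_scm N \<and> same_data M N \<and> p_do_given_xy N x y x' y' = l') \<and>
         (\<exists>N :: ('x \<times> ('x \<Rightarrow> 'y), 'x, 'y) bow_scm.
            is_bow_scm N \<and> same_data M N \<and> p_do_given_xy N x y x' y' = r') \<and>
         {l'..r'} \<subseteq> {l..r}"
proof (intro conjI)
  have pos: "p_xy M x' y' > 0" using positive by blast
  note bounds = p_do_given_xy_bounds[OF scm pos, of x y, folded l' r']
  \<comment> \<open>The query of \<open>M\<close> itself lies in the interval, so it is nonempty and
    each endpoint is an admissible \<open>t\<close>.\<close>
  then have le: "l' \<le> r'" by simp
  show "\<forall>N :: ('v, 'x, 'y) bow_scm.
      is_bow_scm N \<and> same_data M N \<longrightarrow> p_do_given_xy N x y x' y' \<in> {l'..r'}"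
  proof (intro allI impI)
    fix N :: "('v, 'x, 'y) bow_scm"
    assume N: "is_bow_scm N \<and> same_data M N"
    note same = same_dataD[OF scm, of N]
    show "p_do_given_xy N x y x' y' \<in> {l'..r'}"
      using p_do_given_xy_bounds[of N x' y' x y] N pos by (simp add: same l' r')
  qed
  show "\<exists>N :: ('x \<times> ('x \<Rightarrow> 'y), 'x, 'y) bow_scm.
      is_bow_scm N \<and> same_data M N \<and> p_do_given_xy N x y x' y' = l'"
    using ex_scm_attaining[OF scm pos neq, of y l', folded l' r'] le by simp
  show "\<exists>N :: ('x \<times> ('x \<Rightarrow> 'y), 'x, 'y) bow_scm.
      is_bow_scm N \<and> same_data M N \<and> p_do_given_xy N x y x' y' = r'"
    using ex_scm_attaining[OF scm pos neq, of y r', folded l' r'] le by simp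
  have "p_x M x' > 0"
    unfolding p_x_eq_sum[OF scm, where w = x']
    using positive by (intro sum_pos) (auto simp flip: p_xy_eq)
  moreover from this have "p_y_given_x M y' x' > 0"
    using pos by (simp add: p_y_given_x_eq p_xy_eq)
  \<comment> \<open>Here \<open>P(y_x | x')\<close> lies between \<alpha>_min and \<alpha>_max, and
    monotonicity of the endpoints applies.\<close>
  ultimately show "{l'..r'} \<subseteq> {l..r}"
    unfolding l' r' l r using p_do_given_x_bounds[OF scm, of x' x y, folded \<alpha>_min \<alpha>_max]
    by (intro mono_frechet_bounds) auto
qed

end
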